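(* Let $R$ be a domain, $\sigma:R\to R$ a surjective ring endomorphism, and $\delta:R\to R$ a $\sigma$-derivation. If $R$ satisfies RSRC, then so does the Ore extension $R[x;\sigma,\delta]$.
   Context: Rings are associative and unital (not necessarily commutative), and ring homomorphisms preserve unit elements. A domain is a nonzero, not necessarily commutative, ring in which a product of nonzero elements is nonzero. A $\sigma$-derivation is an additive map $\delta:R\to R$ with $\delta(rs)=\delta(r)s+\sigma(r)\delta(s)$ for all $r,s\in R$. The Ore extension $R[x;\sigma,\delta]$ is the ring of all polynomials in the variable $x$ with coefficients in $R$ written on the left (so it is a free left $R$-module on $\{1,x,x^2,\dots\}$), with multiplication governed by $xr=\sigma(r)x+\delta(r)$ for all $r\in R$. A ring $R$ satisfies the right strong rank condition (RSRC) if, for every positive integer $n$, there is no right $R$-module monomorphism $R^{n+1}\to R^n$. *)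

theory Defs
  imports "HOL-Algebra.UnivPoly"
begin

text \<open>The locale \<open>domain\<close> of HOL-Algebra is commutative; here multiplication need not be.\<close>

locale noncomm_domain = ring +
  assumes one_not_zero: "\<one> \<noteq> \<zero>"
    and integral: "\<lbrakk>a \<otimes> b = \<zero>; a \<in> carrier R; b \<in> carrier R\<rbrakk> \<Longrightarrow> a = \<zero> \<or> b = \<zero>"


definition sigma_derivation :: "('a, 'm) ring_scheme \<Rightarrow> ('a \<Rightarrow> 'a) \<Rightarrow> ('a \<Rightarrow> 'a) \<Rightarrow> bool"
  where "sigma_derivation R \<sigma> \<delta> \<longleftrightarrow>
    \<delta> \<in> carrier R \<rightarrow> carrier R \<and>
    (\<forall>r\<in>carrier R. \<forall>s\<in>carrier R. \<delta> (r \<oplus>\<^bsub>R\<^esub> s) = \<delta> r \<oplus>\<^bsub>R\<^esub> \<delta> s) \<and>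
    (\<forall>r\<in>carrier R. \<forall>s\<in>carrier R.
      \<delta> (r \<otimes>\<^bsub>R\<^esub> s) = (\<delta> r \<otimes>\<^bsub>R\<^esub> s) \<oplus>\<^bsub>R\<^esub> (\<sigma> r \<otimes>\<^bsub>R\<^esub> \<delta> s))"


text \<open>
  The rule \<open>x r = \<sigma>(r) x + \<delta>(r)\<close> forces
  \<open>x (\<Sum>\<^sub>j q\<^sub>j x\<^sup>j) = \<Sum>\<^sub>j (\<sigma>(q\<^sub>j) x\<^sup>j\<^sup>+\<^sup>1 + \<delta>(q\<^sub>j) x\<^sup>j)\<close>, whose coefficients are given by
  \<open>ore_shift\<close>, and then \<open>p q = \<Sum>\<^sub>i p\<^sub>i (x\<^sup>i q)\<close>. The left \<open>R\<close>-module of polynomials, with its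
  basis \<open>1, x, x\<^sup>2, \<dots>\<close>, is that of \<open>UP R\<close>; only the multiplication is replaced.
\<close>

definition ore_shift ::
    "('a, 'm) ring_scheme \<Rightarrow> ('a \<Rightarrow> 'a) \<Rightarrow> ('a \<Rightarrow> 'a) \<Rightarrow> (nat \<Rightarrow> 'a) \<Rightarrow> (nat \<Rightarrow> 'a)"
  where "ore_shift R \<sigma> \<delta> q =
    (\<lambda>n. case n of 0 \<Rightarrow> \<delta> (q 0) | Suc m \<Rightarrow> \<sigma> (q m) \<oplus>\<^bsub>R\<^esub> \<delta> (q (Suc m)))"

definition ore_extension ::
    "('a, 'm) ring_scheme \<Rightarrow> ('a \<Rightarrow> 'a) \<Rightarrow> ('a \<Rightarrow> 'a) \<Rightarrow> ('a, nat \<Rightarrow> 'a) up_ring"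
  where "ore_extension R \<sigma> \<delta> = (UP R)\<lparr>mult :=
    (\<lambda>p\<in>up R. \<lambda>q\<in>up R. \<Oplus>\<^bsub>UP R\<^esub>i\<in>{..deg R p}. p i \<odot>\<^bsub>UP R\<^esub> (ore_shift R \<sigma> \<delta> ^^ i) q)\<rparr>"


text \<open>
  The free right module \<open>R\<^sup>n\<close> consists of the functions \<open>{..<n} \<rightarrow>\<^sub>E carrier R\<close>, with
  componentwise addition and with scalars acting componentwise from the right.
\<close>

definition free_right_hom ::
    "('a, 'm) ring_scheme \<Rightarrow> nat \<Rightarrow> nat \<Rightarrow> ((nat \<Rightarrow> 'a) \<Rightarrow> (nat \<Rightarrow> 'a)) set"
  where "free_right_hom R m n =
    {f \<in> ({..<m} \<rightarrow>\<^sub>E carrier R) \<rightarrow> ({..<n} \<rightarrow>\<^sub>E carrier R).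
      (\<forall>v \<in> {..<m} \<rightarrow>\<^sub>E carrier R. \<forall>w \<in> {..<m} \<rightarrow>\<^sub>E carrier R.
        f (\<lambda>i\<in>{..<m}. v i \<oplus>\<^bsub>R\<^esub> w i) = (\<lambda>j\<in>{..<n}. f v j \<oplus>\<^bsub>R\<^esub> f w j)) \<and>
      (\<forall>v \<in> {..<m} \<rightarrow>\<^sub>E carrier R. \<forall>r \<in> carrier R.
        f (\<lambda>i\<in>{..<m}. v i \<otimes>\<^bsub>R\<^esub> r) = (\<lambda>j\<in>{..<n}. f v j \<otimes>\<^bsub>R\<^esub> r))}"

definition RSRC :: "('a, 'm) ring_scheme \<Rightarrow> bool"
  where "RSRC R \<longleftrightarrow> (\<forall>n>0. \<not> (\<exists>f \<in> free_right_hom R (n + 1) n.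
    inj_on f ({..<n + 1} \<rightarrow>\<^sub>E carrier R)))"


text \<open>
  The multiplication above does make \<open>R[x;\<sigma>,\<delta>]\<close> a ring with \<open>x r = \<sigma>(r) x + \<delta>(r)\<close>, in which
  \<open>monom a n\<close> is \<open>a x\<^sup>n\<close>.
\<close>

locale ore_data = UP_ring R P for R (structure) and P (structure) +
  fixes \<sigma> \<delta> :: "'a \<Rightarrow> 'a" and S :: "('a, nat \<Rightarrow> 'a) up_ring"
  assumes sigma: "\<sigma> \<in> ring_hom R R"
    and delta: "sigma_derivation R \<sigma> \<delta>"
  defines S_def: "S \<equiv> ore_extension R \<sigma> \<delta>"
begin

abbreviation X where "X \<equiv> ore_shift R \<sigma> \<delta>"

lemma sigma_simps [simp]:
  "a \<in> carrier R \<Longrightarrow> \<sigma> a \<in> carrier R"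
  "\<lbrakk>a \<in> carrier R; b \<in> carrier R\<rbrakk> \<Longrightarrow> \<sigma> (a \<oplus> b) = \<sigma> a \<oplus> \<sigma> b"
  "\<lbrakk>a \<in> carrier R; b \<in> carrier R\<rbrakk> \<Longrightarrow> \<sigma> (a \<otimes> b) = \<sigma> a \<otimes> \<sigma> b"
  "\<sigma> \<one> = \<one>"
  "\<sigma> \<zero> = \<zero>"
  using sigma ring_hom_zero[OF sigma R.ring_axioms R.ring_axioms]
  by (auto simp: ring_hom_def)

lemma delta_simps [simp]:
  "a \<in> carrier R \<Longrightarrow> \<delta> a \<in> carrier R"
  "\<lbrakk>a \<in> carrier R; b \<in> carrier R\<rbrakk> \<Longrightarrow> \<delta> (a \<oplus> b) = \<delta> a \<oplus> \<delta> b"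
  "\<lbrakk>a \<in> carrier R; b \<in> carrier R\<rbrakk> \<Longrightarrow> \<delta> (a \<otimes> b) = (\<delta> a \<otimes> b) \<oplus> (\<sigma> a \<otimes> \<delta> b)"
  using delta by (auto simp: sigma_derivation_def)

lemma delta_zero [simp]: "\<delta> \<zero> = \<zero>"
proof -
  have "\<delta> (\<zero> \<oplus> \<zero>) = \<delta> \<zero> \<oplus> \<delta> \<zero>" by (rule delta_simps) auto
  then show ?thesis by simp
qed

lemma delta_one [simp]: "\<delta> \<one> = \<zero>"
proof -
  have "\<delta> (\<one> \<otimes> \<one>) = (\<delta> \<one> \<otimes> \<one>) \<oplus> (\<sigma> \<one> \<otimes> \<delta> \<one>)" by (rule delta_simps) auto
  then show ?thesis by simp
qed

lemma carrier_P: "carrier P = up R"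
  by (simp add: P_def UP_def)

lemma coeff_eq: "p \<in> carrier P \<Longrightarrow> coeff P p n = p n"
  by (simp add: P_def UP_def)

lemma X_closed [simp]:
  assumes p: "p \<in> carrier P"
  shows "X p \<in> carrier P"
proof -
  have *: "p \<in> up R" using p carrier_P by simp
  have c: "p i \<in> carrier R" for i using * by auto
  obtain n where n: "bound \<zero> n p" using * by auto
  have "bound \<zero> (Suc n) (X p)"
  proof
    fix m assume "Suc n < m"
    then show "X p m = \<zero>" using n by (cases m) (auto simp: ore_shift_def bound_def)
  qed
  moreover have "X p i \<in> carrier R" for i
    by (cases i) (auto simp: ore_shift_def c)
  ultimately show ?thesis unfolding carrier_P by blast
qed

lemma coeff_X: "p \<in> carrier P \<Longrightarrow> coeff P (X p) n =
    (case n of 0 \<Rightarrow> \<delta> (coeff P p 0) | Suc m \<Rightarrow> \<sigma> (coeff P p m) \<oplus> \<delta> (coeff P p (Suc m)))"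
  by (subst (1) coeff_eq, simp, simp add: ore_shift_def coeff_eq cong: nat.case_cong)

lemma X_add:
  "\<lbrakk>p \<in> carrier P; q \<in> carrier P\<rbrakk> \<Longrightarrow> X (p \<oplus>\<^bsub>P\<^esub> q) = X p \<oplus>\<^bsub>P\<^esub> X q"
  by (rule up_eqI) (auto simp: coeff_X R.a_ac split: nat.split)

lemma X_smult:
  "\<lbrakk>a \<in> carrier R; p \<in> carrier P\<rbrakk> \<Longrightarrow>
    X (a \<odot>\<^bsub>P\<^esub> p) = \<sigma> a \<odot>\<^bsub>P\<^esub> X p \<oplus>\<^bsub>P\<^esub> \<delta> a \<odot>\<^bsub>P\<^esub> p"
  by (rule up_eqI) (auto simp: coeff_X R.a_ac R.r_distr split: nat.split)

lemma X_pow_closed [simp]: "p \<in> carrier P \<Longrightarrow> (X ^^ i) p \<in> carrier P"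
  by (induction i) auto

lemma X_pow_add:
  "\<lbrakk>p \<in> carrier P; q \<in> carrier P\<rbrakk> \<Longrightarrow> (X ^^ i) (p \<oplus>\<^bsub>P\<^esub> q) = (X ^^ i) p \<oplus>\<^bsub>P\<^esub> (X ^^ i) q"
  by (induction i) (auto simp: X_add)

definition trunc :: "nat \<Rightarrow> (nat \<Rightarrow> 'a) \<Rightarrow> (nat \<Rightarrow> 'a) \<Rightarrow> (nat \<Rightarrow> 'a)"
  where "trunc N p q = (\<Oplus>\<^bsub>P\<^esub>i\<in>{..N}. coeff P p i \<odot>\<^bsub>P\<^esub> (X ^^ i) q)"

lemma trunc_0:
  "\<lbrakk>p \<in> carrier P; q \<in> carrier P\<rbrakk> \<Longrightarrow> trunc 0 p q = coeff P p 0 \<odot>\<^bsub>P\<^esub> q"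
  by (simp add: trunc_def)

lemma trunc_Suc:
  "\<lbrakk>p \<in> carrier P; q \<in> carrier P\<rbrakk> \<Longrightarrow>
    trunc (Suc N) p q = coeff P p (Suc N) \<odot>\<^bsub>P\<^esub> (X ^^ Suc N) q \<oplus>\<^bsub>P\<^esub> trunc N p q"
  unfolding trunc_def by (subst P.finsum_Suc) auto

lemma trunc_closed [simp]:
  "\<lbrakk>p \<in> carrier P; q \<in> carrier P\<rbrakk> \<Longrightarrow> trunc N p q \<in> carrier P"
  unfolding trunc_def by (rule P.finsum_closed) auto

lemma trunc_mono:
  assumes "p \<in> carrier P" "q \<in> carrier P" "N \<le> M" "bound \<zero> N (coeff P p)"
  shows "trunc M p q = trunc N p q"
  using assms(3)
proof (induction M rule: dec_induct)
  case (step M)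
  have "coeff P p (Suc M) = \<zero>" using assms(4) step by (simp add: bound_def)
  then show ?case using assms step by (simp add: trunc_Suc del: funpow.simps)
qed simp

lemma ore_simps [simp]:
  "carrier S = carrier P" "add S = add P" "zero S = zero P" "one S = one P"
  "smult S = smult P" "monom S = monom P" "coeff S = coeff P"
  by (simp_all add: S_def ore_extension_def P_def)

lemma bound_deg: "p \<in> carrier P \<Longrightarrow> bound \<zero> (deg R p) (coeff P p)"
  using deg_aboveD by blast

lemma mult_eq:
  assumes "p \<in> carrier P" "q \<in> carrier P" "bound \<zero> N (coeff P p)"
  shows "p \<otimes>\<^bsub>S\<^esub> q = trunc N p q"
proof -
  have "p \<otimes>\<^bsub>S\<^esub> q = (\<Oplus>\<^bsub>P\<^esub>i\<in>{..deg R p}. p i \<odot>\<^bsub>P\<^esub> (X ^^ i) q)"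
    using assms by (simp add: S_def ore_extension_def P_def[symmetric] carrier_P)
  also have "\<dots> = trunc (deg R p) p q"
    using assms by (simp add: trunc_def coeff_eq)
  also have "\<dots> = trunc (max N (deg R p)) p q"
    using assms bound_deg[of p] by (intro trunc_mono[symmetric]) auto
  also have "\<dots> = trunc N p q"
    using assms by (intro trunc_mono) auto
  finally show ?thesis .
qed

lemma ex_bound: "p \<in> carrier P \<Longrightarrow> \<exists>N. \<forall>M\<ge>N. bound \<zero> M (coeff P p)"
  using bound_deg[of p] by (intro exI[of _ "deg R p"]) (auto simp: bound_def)

lemma mult_closed [simp]:
  assumes "p \<in> carrier P" "q \<in> carrier P"
  shows "p \<otimes>\<^bsub>S\<^esub> q \<in> carrier P"
  using mult_eq[OF assms bound_deg[OF assms(1)]] assms by simp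

lemma trunc_add_left:
  "\<lbrakk>p \<in> carrier P; p' \<in> carrier P; q \<in> carrier P\<rbrakk> \<Longrightarrow>
    trunc N (p \<oplus>\<^bsub>P\<^esub> p') q = trunc N p q \<oplus>\<^bsub>P\<^esub> trunc N p' q"
  by (induction N)
    (simp_all add: trunc_0 trunc_Suc UP_smult_l_distr P.a_ac del: funpow.simps)

lemma trunc_smult_left:
  "\<lbrakk>a \<in> carrier R; p \<in> carrier P; q \<in> carrier P\<rbrakk> \<Longrightarrow>
    trunc N (a \<odot>\<^bsub>P\<^esub> p) q = a \<odot>\<^bsub>P\<^esub> trunc N p q"
  by (induction N)
    (simp_all add: trunc_0 trunc_Suc UP_smult_r_distr UP_smult_assoc1 del: funpow.simps)

lemma trunc_add_right:
  "\<lbrakk>p \<in> carrier P; q' \<in> carrier P; q \<in> carrier P\<rbrakk> \<Longrightarrow>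
    trunc N p (q \<oplus>\<^bsub>P\<^esub> q') = trunc N p q \<oplus>\<^bsub>P\<^esub> trunc N p q'"
  by (induction N)
    (simp_all add: trunc_0 trunc_Suc UP_smult_r_distr X_pow_add P.a_ac del: funpow.simps)

lemma mult_add_left:
  assumes "p \<in> carrier P" "p' \<in> carrier P" "q \<in> carrier P"
  shows "(p \<oplus>\<^bsub>P\<^esub> p') \<otimes>\<^bsub>S\<^esub> q = p \<otimes>\<^bsub>S\<^esub> q \<oplus>\<^bsub>P\<^esub> p' \<otimes>\<^bsub>S\<^esub> q"
proof -
  let ?N = "max (deg R p) (deg R p')"
  have "bound \<zero> ?N (coeff P p)" "bound \<zero> ?N (coeff P p')"
    "bound \<zero> ?N (coeff P (p \<oplus>\<^bsub>P\<^esub> p'))"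
    using assms bound_deg[of p] bound_deg[of p'] by (auto simp: bound_def)
  then show ?thesis using assms by (simp add: mult_eq[where N = ?N] trunc_add_left)
qed

lemma mult_smult_left:
  assumes "a \<in> carrier R" "p \<in> carrier P" "q \<in> carrier P"
  shows "(a \<odot>\<^bsub>P\<^esub> p) \<otimes>\<^bsub>S\<^esub> q = a \<odot>\<^bsub>P\<^esub> (p \<otimes>\<^bsub>S\<^esub> q)"
proof -
  let ?N = "deg R p"
  have "bound \<zero> ?N (coeff P p)" "bound \<zero> ?N (coeff P (a \<odot>\<^bsub>P\<^esub> p))"
    using assms bound_deg[of p] by (auto simp: bound_def)
  then show ?thesis using assms by (simp add: mult_eq[where N = ?N] trunc_smult_left)
qed

lemma X_trunc:
  assumes "p \<in> carrier P" "q \<in> carrier P"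
  shows "X (trunc N p q) =
    trunc N (X p) q \<oplus>\<^bsub>P\<^esub> \<sigma> (coeff P p N) \<odot>\<^bsub>P\<^esub> (X ^^ Suc N) q"
proof (induction N)
  case 0
  then show ?case using assms by (simp add: trunc_0 X_smult coeff_X P.a_ac)
next
  case (Suc N)
  then show ?case using assms
    by (simp add: trunc_Suc X_smult X_add coeff_X UP_smult_l_distr P.a_ac)
qed

lemma X_mult:
  assumes "p \<in> carrier P" "q \<in> carrier P"
  shows "X (p \<otimes>\<^bsub>S\<^esub> q) = X p \<otimes>\<^bsub>S\<^esub> q"
proof -
  define N where "N = deg R p"
  have N: "bound \<zero> N (coeff P p)" using assms bound_deg N_def by simp
  then have *: "bound \<zero> (Suc N) (coeff P (X p))"
    using assms by (auto simp: bound_def coeff_X split: nat.split)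
  have "X p \<otimes>\<^bsub>S\<^esub> q = trunc (Suc N) (X p) q" using assms * by (intro mult_eq) auto
  also have "\<dots> = \<sigma> (coeff P p N) \<odot>\<^bsub>P\<^esub> (X ^^ Suc N) q \<oplus>\<^bsub>P\<^esub> trunc N (X p) q"
    using assms N by (simp add: trunc_Suc coeff_X bound_def)
  also have "\<dots> = X (trunc N p q)" using assms by (simp add: X_trunc P.a_ac)
  finally show ?thesis using assms N by (simp add: mult_eq)
qed

lemma X_pow_mult:
  "\<lbrakk>p \<in> carrier P; q \<in> carrier P\<rbrakk> \<Longrightarrow> (X ^^ i) (p \<otimes>\<^bsub>S\<^esub> q) = (X ^^ i) p \<otimes>\<^bsub>S\<^esub> q"
  by (induction i) (auto simp: X_mult)

lemma mult_assoc:
  assumes "p \<in> carrier P" "q \<in> carrier P" "r \<in> carrier P"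
  shows "(p \<otimes>\<^bsub>S\<^esub> q) \<otimes>\<^bsub>S\<^esub> r = p \<otimes>\<^bsub>S\<^esub> (q \<otimes>\<^bsub>S\<^esub> r)"
proof -
  have "trunc N p q \<otimes>\<^bsub>S\<^esub> r = trunc N p (q \<otimes>\<^bsub>S\<^esub> r)" for N
    by (induction N)
      (use assms in \<open>simp_all add: trunc_0 trunc_Suc mult_add_left mult_smult_left X_pow_mult
        del: funpow.simps\<close>)
  then show ?thesis using assms bound_deg[of p] by (simp add: mult_eq)
qed

lemma monom_mult_eq:
  assumes "a \<in> carrier R" "q \<in> carrier P"
  shows "monom P a n \<otimes>\<^bsub>S\<^esub> q = a \<odot>\<^bsub>P\<^esub> (X ^^ n) q"
proof -
  have "trunc m (monom P a n) q = (if n \<le> m then a \<odot>\<^bsub>P\<^esub> (X ^^ n) q else \<zero>\<^bsub>P\<^esub>)" for m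
    by (induction m) (use assms in \<open>auto simp: trunc_0 trunc_Suc le_Suc_eq simp del: funpow.simps\<close>)
  moreover have "bound \<zero> n (coeff P (monom P a n))" using assms by auto
  ultimately show ?thesis using assms by (simp add: mult_eq)
qed

lemma X_monom: "a \<in> carrier R \<Longrightarrow> X (monom P a n) = monom P (\<sigma> a) (Suc n) \<oplus>\<^bsub>P\<^esub> monom P (\<delta> a) n"
  by (rule up_eqI) (auto simp: coeff_X split: nat.split)

lemma X_pow_one: "(X ^^ n) \<one>\<^bsub>P\<^esub> = monom P \<one> n"
  by (induction n) (auto simp: X_monom)

lemma one_mult: "q \<in> carrier P \<Longrightarrow> \<one>\<^bsub>P\<^esub> \<otimes>\<^bsub>S\<^esub> q = q"
  using monom_mult_eq[of \<one> q 0] by simp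

lemma mult_one: 
  assumes "p \<in> carrier P"
  shows "p \<otimes>\<^bsub>S\<^esub> \<one>\<^bsub>P\<^esub> = p"
proof -
  have "coeff P (trunc N p \<one>\<^bsub>P\<^esub>) i = (if i \<le> N then coeff P p i else \<zero>)" for N i
    by (induction N)
      (use assms in \<open>auto simp: trunc_0 trunc_Suc X_pow_one le_Suc_eq simp del: funpow.simps\<close>)
  then show ?thesis using assms bound_deg[of p]
    by (intro up_eqI) (auto simp: mult_eq bound_def not_le)
qed

theorem ore_extension_ring: "ring S"
proof (intro ringI)
  show "abelian_group S"
  proof (intro abelian_groupI)
    fix x assume "x \<in> carrier S"
    then show "\<exists>y\<in>carrier S. y \<oplus>\<^bsub>S\<^esub> x = \<zero>\<^bsub>S\<^esub>" using UP_l_neg_ex by simp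
  qed (auto simp: P.a_ac)
  show "monoid S"
    by (intro monoidI) (auto simp: mult_assoc one_mult mult_one)
next
  fix x y z assume "x \<in> carrier S" "y \<in> carrier S" "z \<in> carrier S"
  then show "(x \<oplus>\<^bsub>S\<^esub> y) \<otimes>\<^bsub>S\<^esub> z = x \<otimes>\<^bsub>S\<^esub> z \<oplus>\<^bsub>S\<^esub> y \<otimes>\<^bsub>S\<^esub> z"
    by (simp add: mult_add_left)
next
  fix x y z assume "x \<in> carrier S" "y \<in> carrier S" "z \<in> carrier S"
  then show "z \<otimes>\<^bsub>S\<^esub> (x \<oplus>\<^bsub>S\<^esub> y) = z \<otimes>\<^bsub>S\<^esub> x \<oplus>\<^bsub>S\<^esub> z \<otimes>\<^bsub>S\<^esub> y"
    using bound_deg[of z] by (simp add: mult_eq trunc_add_right)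
qed

theorem ore_extension_commutation:
  assumes "r \<in> carrier R"
  shows "monom S \<one> 1 \<otimes>\<^bsub>S\<^esub> monom S r 0 =
    (monom S (\<sigma> r) 0 \<otimes>\<^bsub>S\<^esub> monom S \<one> 1) \<oplus>\<^bsub>S\<^esub> monom S (\<delta> r) 0"
proof -
  have "\<sigma> r \<odot>\<^bsub>P\<^esub> monom P \<one> 1 = monom P (\<sigma> r) 1"
    using assms by (simp add: monom_mult_smult[symmetric])
  then show ?thesis using assms by (simp add: monom_mult_eq X_monom)
qed

theorem ore_extension_monom:
  assumes "a \<in> carrier R"
  shows "monom S a n = monom S a 0 \<otimes>\<^bsub>S\<^esub> monom S \<one> 1 [^]\<^bsub>S\<^esub> n"
proof -
  interpret S: ring S by (rule ore_extension_ring)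
  have "monom P \<one> 1 [^]\<^bsub>S\<^esub> n = monom P \<one> n"
  proof (induction n)
    case (Suc n)
    then have "monom P \<one> 1 [^]\<^bsub>S\<^esub> Suc n = monom P \<one> n \<otimes>\<^bsub>S\<^esub> monom P \<one> 1" by simp
    also have "\<dots> = (X ^^ n) ((X ^^ 1) \<one>\<^bsub>P\<^esub>)"
      using X_pow_one[of 1] by (simp add: monom_mult_eq)
    also have "\<dots> = (X ^^ Suc n) \<one>\<^bsub>P\<^esub>" by (simp add: funpow_swap1)
    finally show ?case by (simp only: X_pow_one)
  qed simp
  then show ?thesis using assms by (simp add: monom_mult_eq monom_mult_smult[symmetric])
qed

end

end

theory Submission
  imports Defs "HOL-Algebra.Multiplicative_Group"
begin

text \<open>
  Suppose \<open>f : S\<^bsup>n+1\<^esup> \<rightarrow> S\<^bsup>n\<^esup>\<close> is a monomorphism over \<open>S = R[x;\<sigma>,\<delta>]\<close>, whose matrix entries have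
  degree at most \<open>d\<close>. Since \<open>\<sigma>\<close> is surjective, the polynomials of degree less than \<open>k\<close> are the
  right combinations \<open>\<Sum>\<^sub>i\<^sub><\<^sub>k x\<^sup>i r\<^sub>i\<close>.
  If \<open>\<sigma>\<close> is injective, these combinations are unique, and \<open>f\<close> restricts to an \<open>R\<close>-linear
  injection of the vectors of degree at most \<open>dn\<close> into those of degree at most \<open>dn + d\<close>, free
  modules of ranks \<open>(dn + 1)(n + 1)\<close> and \<open>(dn + d + 1)n\<close>; the former exceeds the latter by one.
  If \<open>0 \<noteq> r \<in> ker \<sigma>\<close>, then \<open>x r = \<delta>(r)\<close>, so right multiplication by \<open>r\<^sup>d\<close> moves all matrix
  entries into \<open>R\<close>, and \<open>v \<mapsto> f (r\<^sup>d v)\<close> is an injection \<open>R\<^bsup>n+1\<^esup> \<rightarrow> R\<^bsup>n\<^esup>\<close>.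
\<close>

section \<open>Matrices of maps between free right modules\<close>

text \<open>Additivity lets \<open>v\<close> be assembled one coordinate at a time, and each
  coordinate is a right multiple of a unit vector. Through this formula, degree bounds on the matrix
  entries pass to all values of \<open>f\<close>.\<close>

lemma (in ring) free_right_hom_eq_matrix:
  assumes f: "f \<in> free_right_hom R m n"
    and v: "v \<in> {..<m} \<rightarrow>\<^sub>E carrier R" and i: "i < n"
  shows "f v i = (\<Oplus>j\<in>{..<m}. f (\<lambda>l\<in>{..<m}. if l = j then \<one> else \<zero>) i \<otimes> v j)"
proof -
  let ?e = "\<lambda>j. \<lambda>l\<in>{..<m}. if l = j then \<one> else \<zero>"
  \<comment> \<open>The vector \<open>v\<close> cut off after its first \<open>k\<close>
    coordinates; the induction below runs over \<open>k\<close>.\<close>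
  let ?c = "\<lambda>k. \<lambda>l\<in>{..<m}. if l < k then v l else \<zero>"
  have e: "?e j \<in> {..<m} \<rightarrow>\<^sub>E carrier R" for j by auto
  have v': "v l \<in> carrier R" if "l < m" for l using v that by auto
  have c: "?c k \<in> {..<m} \<rightarrow>\<^sub>E carrier R" for k using v' by auto
  have add: "f (\<lambda>l\<in>{..<m}. x l \<oplus> y l) i = f x i \<oplus> f y i"
    if "x \<in> {..<m} \<rightarrow>\<^sub>E carrier R" "y \<in> {..<m} \<rightarrow>\<^sub>E carrier R" for x y
    using f that i by (simp add: free_right_hom_def)
  have scal: "f (\<lambda>l\<in>{..<m}. x l \<otimes> r) i = f x i \<otimes> r"
    if "x \<in> {..<m} \<rightarrow>\<^sub>E carrier R" "r \<in> carrier R" for x r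
    using f that i by (simp add: free_right_hom_def)
  have cl: "f x i \<in> carrier R" if "x \<in> {..<m} \<rightarrow>\<^sub>E carrier R" for x
    using f that i unfolding free_right_hom_def by blast
  define F where "F j = f (?e j) i \<otimes> v j" for j
  have F: "F j \<in> carrier R" if "j < m" for j
    unfolding F_def using cl[OF e] v'[OF that] by (rule m_closed)
  have part: "f (?c k) i = finsum R F {..<k}" if "k \<le> m" for k
    using that
  proof (induction k)
    case 0
    \<comment> \<open>The zero vector is its own multiple by zero, so homogeneity alone makes its
      image zero.\<close>
    have "(\<lambda>l\<in>{..<m}. ?c 0 l \<otimes> \<zero>) = ?c 0" by auto
    then have "f (?c 0) i = f (?c 0) i \<otimes> \<zero>" using scal[OF c zero_closed, of 0] by metis
    then have "f (?c 0) i = \<zero>" using cl[OF c, of 0] r_null by metis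
    then show ?case by (simp only: lessThan_0 finsum_empty)
  next
    case (Suc k)
    let ?ev = "\<lambda>l\<in>{..<m}. ?e k l \<otimes> v k"
    have vk: "v k \<in> carrier R" using Suc v' by simp
    have ev: "?ev \<in> {..<m} \<rightarrow>\<^sub>E carrier R" using vk by auto
    have FS: "F \<in> {..<k} \<rightarrow> carrier R" "F k \<in> carrier R" using F Suc.prems by auto
    have "?c (Suc k) = (\<lambda>l\<in>{..<m}. ?c k l \<oplus> ?ev l)"
      using v' vk by (auto simp: fun_eq_iff less_Suc_eq)
    then have "f (?c (Suc k)) i = f (?c k) i \<oplus> F k"
      using add[OF c ev, of k] scal[OF e vk, of k] by (simp add: F_def)
    also have "\<dots> = finsum R F {..<k} \<oplus> F k"
      by (simp only: Suc.IH[OF Suc_leD[OF Suc.prems]])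
    also have "\<dots> = finsum R F {..<Suc k}"
      unfolding lessThan_Suc using FS by (simp add: finsum_insert a_comm)
    finally show ?case .
  qed
  have cm: "?c m = v" using v by (auto simp: fun_eq_iff PiE_def extensional_def)
  from part[OF order_refl] have "f v i = finsum R F {..<m}" unfolding cm .
  then show ?thesis unfolding F_def .
qed

context ore_data
begin

section \<open>Polynomials of bounded degree\<close>

text \<open>The bound is strict: \<open>low 0\<close> is the zero module and
  \<open>low (Suc d)\<close> means degree at most \<open>d\<close>. This sidesteps the convention
  that \<open>deg\<close> of the zero polynomial is 0, and \<open>k\<close> is also the number of
  coefficients.\<close>

definition low :: "nat \<Rightarrow> (nat \<Rightarrow> 'a) set"
  where "low k = {p \<in> carrier P. \<forall>i\<ge>k. coeff P p i = \<zero>}"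

lemma low_carrier: "p \<in> low k \<Longrightarrow> p \<in> carrier P"
  by (simp add: low_def)

lemma low_zero: "\<zero>\<^bsub>P\<^esub> \<in> low k"
  by (simp add: low_def)

lemma low_add: "\<lbrakk>p \<in> low k; q \<in> low k\<rbrakk> \<Longrightarrow> p \<oplus>\<^bsub>P\<^esub> q \<in> low k"
  by (simp add: low_def)

lemma low_smult: "\<lbrakk>a \<in> carrier R; p \<in> low k\<rbrakk> \<Longrightarrow> a \<odot>\<^bsub>P\<^esub> p \<in> low k"
  by (simp add: low_def)

lemma low_mono: "\<lbrakk>p \<in> low k; k \<le> l\<rbrakk> \<Longrightarrow> p \<in> low l"
  by (simp add: low_def)

lemma low_finsum: "(\<And>i. i \<in> A \<Longrightarrow> g i \<in> low k) \<Longrightarrow> (\<Oplus>\<^bsub>P\<^esub>i\<in>A. g i) \<in> low k"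
proof (induction A rule: infinite_finite_induct)
  case (insert x F)
  have "g \<in> F \<rightarrow> carrier P" "g x \<in> carrier P" using insert.prems low_carrier by auto
  with insert show ?case by (simp add: low_add)
qed (auto simp: low_zero P.finsum_infinite)

lemma ex_low: "p \<in> carrier P \<Longrightarrow> \<exists>d. p \<in> low (Suc d)"
  using deg_aboveD by (intro exI[of _ "deg R p"]) (auto simp: low_def)

lemma const_low: "a \<in> carrier R \<Longrightarrow> monom P a 0 \<in> low (Suc 0)"
  by (auto simp: low_def)

lemma X_low: "p \<in> low k \<Longrightarrow> X p \<in> low (Suc k)"
  by (auto simp: low_def coeff_X split: nat.split)

lemma X_pow_low: "p \<in> low k \<Longrightarrow> (X ^^ i) p \<in> low (i + k)"
  by (induction i) (auto simp: X_low)

lemma low_bound: "p \<in> low (Suc d) \<Longrightarrow> bound \<zero> d (coeff P p)"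
  by (auto simp: low_def bound_def)

text \<open>The product is a left combination of the \<open>x^i p\<close> with \<open>i\<close> at
  most \<open>d\<close>, and each factor \<open>x\<close> raises the degree by at most one.\<close>

lemma low_mult:
  assumes s: "s \<in> low (Suc d)" and p: "p \<in> low k"
  shows "s \<otimes>\<^bsub>S\<^esub> p \<in> low (d + k)"
proof -
  have sp: "s \<in> carrier P" "p \<in> carrier P" using s p low_carrier by auto
  have "trunc d s p \<in> low (d + k)"
    unfolding trunc_def
    by (intro low_finsum low_smult low_mono[OF X_pow_low[OF p]]) (use sp in auto)
  then show ?thesis using mult_eq[OF sp low_bound[OF s]] by simp
qed

section \<open>Expansions with coefficients on the right\<close>

text \<open>Each time \<open>x\<close> passes a coefficient, \<open>\<delta>\<close> contributes
  only to lower degrees, so the leading coefficient sees \<open>\<sigma>\<close> alone.\<close>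

lemma coeff_X_pow_const:
  assumes "a \<in> carrier R"
  shows "coeff P ((X ^^ k) (monom P a 0)) k = (\<sigma> ^^ k) a"
proof (induction k)
  case (Suc k)
  have "(X ^^ k) (monom P a 0) \<in> low (Suc k)"
    using X_pow_low[OF const_low[OF assms]] by simp
  then have "coeff P ((X ^^ k) (monom P a 0)) (Suc k) = \<zero>" by (simp add: low_def)
  moreover have "(\<sigma> ^^ k) a \<in> carrier R"
    using Suc[symmetric] assms by simp
  ultimately show ?case using Suc assms by (simp add: coeff_X)
qed (use assms in simp)

text \<open>The element \<open>\<Sum>\<^sub>i x\<^sup>i (w i)\<close>, with coefficients on the right.\<close>

primrec rpoly :: "nat \<Rightarrow> (nat \<Rightarrow> 'a) \<Rightarrow> (nat \<Rightarrow> 'a)" where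
  "rpoly 0 w = \<zero>\<^bsub>P\<^esub>"
| "rpoly (Suc k) w = rpoly k w \<oplus>\<^bsub>P\<^esub> (X ^^ k) (monom P (w k) 0)"

lemma rpoly_low: "(\<And>i. i < k \<Longrightarrow> w i \<in> carrier R) \<Longrightarrow> rpoly k w \<in> low k"
proof (induction k)
  case (Suc k)
  have "(X ^^ k) (monom P (w k) 0) \<in> low (Suc k)"
    using X_pow_low[OF const_low, of "w k" k] Suc.prems by simp
  moreover have "rpoly k w \<in> low (Suc k)"
    using Suc.prems by (intro low_mono[OF Suc.IH]) auto
  ultimately show ?case by (simp add: low_add)
qed (simp add: low_zero)

lemma rpoly_closed: "(\<And>i. i < k \<Longrightarrow> w i \<in> carrier R) \<Longrightarrow> rpoly k w \<in> carrier P"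
  using rpoly_low low_carrier by blast

lemma rpoly_cong: "(\<And>i. i < k \<Longrightarrow> w i = w' i) \<Longrightarrow> rpoly k w = rpoly k w'"
  by (induction k) auto

lemma rpoly_add:
  "\<lbrakk>\<And>i. i < k \<Longrightarrow> w i \<in> carrier R; \<And>i. i < k \<Longrightarrow> w' i \<in> carrier R\<rbrakk> \<Longrightarrow>
    rpoly k (\<lambda>i. w i \<oplus> w' i) = rpoly k w \<oplus>\<^bsub>P\<^esub> rpoly k w'"
proof (induction k)
  case (Suc k)
  have "rpoly k w \<in> carrier P" "rpoly k w' \<in> carrier P"
    using Suc.prems by (auto intro!: rpoly_closed)
  with Suc show ?case by (simp add: X_pow_add P.a_ac)
qed simp

lemma const_mult:
  "\<lbrakk>a \<in> carrier R; b \<in> carrier R\<rbrakk> \<Longrightarrow> monom P a 0 \<otimes>\<^bsub>S\<^esub> monom P b 0 = monom P (a \<otimes> b) 0"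
  by (simp add: monom_mult_eq monom_mult_smult)

text \<open>The reason for writing coefficients on the right: scalars from \<open>R\<close> then act
  coordinatewise, without a twist by \<open>\<sigma>\<close> or \<open>\<delta>\<close>, so
  coordinates are compatible with right \<open>R\<close>-linearity.\<close>

lemma rpoly_scale:
  "\<lbrakk>\<And>i. i < k \<Longrightarrow> w i \<in> carrier R; r \<in> carrier R\<rbrakk> \<Longrightarrow>
    rpoly k (\<lambda>i. w i \<otimes> r) = rpoly k w \<otimes>\<^bsub>S\<^esub> monom P r 0"
proof (induction k)
  case 0
  interpret S: ring S by (rule ore_extension_ring)
  show ?case using 0 S.l_null[of "monom P r 0"] by simp
next
  case (Suc k)
  have "rpoly k w \<in> carrier P" using Suc.prems by (auto intro!: rpoly_closed)
  with Suc show ?case by (simp add: mult_add_left const_mult[symmetric] X_pow_mult)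
qed

lemma coeff_rpoly_top:
  assumes "\<And>i. i < Suc k \<Longrightarrow> w i \<in> carrier R"
  shows "coeff P (rpoly (Suc k) w) k = (\<sigma> ^^ k) (w k)"
proof -
  have "rpoly k w \<in> low k" "w k \<in> carrier R" using assms by (auto intro!: rpoly_low)
  moreover from this have "(\<sigma> ^^ k) (w k) \<in> carrier R"
    using coeff_X_pow_const[of "w k" k, symmetric] by simp
  ultimately show ?thesis by (simp add: low_def coeff_X_pow_const)
qed

text \<open>The top coefficient determines \<open>w k\<close>, because powers of an injective
  \<open>\<sigma>\<close> are injective; cancelling the top term leaves shorter expansions.\<close>

lemma rpoly_inj:
  assumes "inj_on \<sigma> (carrier R)"
  shows "\<lbrakk>\<And>i. i < k \<Longrightarrow> w i \<in> carrier R; \<And>i. i < k \<Longrightarrow> w' i \<in> carrier R;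
    rpoly k w = rpoly k w'; i < k\<rbrakk> \<Longrightarrow> w i = w' i"
proof (induction k)
  case (Suc k)
  have pow: "(\<sigma> ^^ j) a \<in> carrier R" if "a \<in> carrier R" for a j
    using that by (induction j) auto
  have pow_inj: "(\<sigma> ^^ j) a = (\<sigma> ^^ j) b \<Longrightarrow> a = b"
    if "a \<in> carrier R" "b \<in> carrier R" for a b j
    using that assms pow by (induction j) (auto dest: inj_onD)
  have top: "w k = w' k"
  proof (rule pow_inj)
    show "(\<sigma> ^^ k) (w k) = (\<sigma> ^^ k) (w' k)"
      using coeff_rpoly_top[of k w] coeff_rpoly_top[of k w'] Suc.prems(1-3) by simp
  qed (use Suc.prems in auto)
  have "rpoly k w \<in> carrier P" "rpoly k w' \<in> carrier P"
    using Suc.prems by (auto intro!: rpoly_closed)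
  then have "rpoly k w = rpoly k w'" using Suc.prems top by simp
  then show ?case using Suc top by (cases "i = k") auto
qed simp

text \<open>Surjectivity of \<open>\<sigma>\<close> enters here: the top coefficient of
  \<open>p\<close> is \<open>(\<sigma> ^^ k) a\<close> for some \<open>a\<close>, and subtracting
  \<open>x^k a\<close> lowers the degree bound.\<close>

lemma low_rpoly:
  assumes surj: "\<sigma> ` carrier R = carrier R"
  shows "p \<in> low k \<Longrightarrow> \<exists>w \<in> {..<k} \<rightarrow>\<^sub>E carrier R. rpoly k w = p"
proof (induction k arbitrary: p)
  case 0
  then have "p \<in> carrier P" "coeff P p i = \<zero>" for i by (simp_all add: low_def)
  then have "p = \<zero>\<^bsub>P\<^esub>" by (intro up_eqI) simp_all
  \<comment> \<open>The only extensional function on the empty index set.\<close>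
  then show ?case by (intro bexI[of _ "\<lambda>_. undefined"]) simp_all
next
  case (Suc k)
  have p: "p \<in> carrier P" using Suc.prems low_carrier by auto
  have "(\<sigma> ^^ j) ` carrier R = carrier R" for j
  proof (induction j)
    case (Suc j)
    have "(\<sigma> ^^ Suc j) ` carrier R = \<sigma> ` (\<sigma> ^^ j) ` carrier R" by (simp add: image_image)
    then show ?case by (simp only: Suc.IH surj)
  qed simp
  with p have "coeff P p k \<in> (\<sigma> ^^ k) ` carrier R" by simp
  then obtain a where a: "a \<in> carrier R" "coeff P p k = (\<sigma> ^^ k) a" by blast
  let ?t = "(X ^^ k) (monom P a 0)"
  have t: "?t \<in> low (Suc k)" "?t \<in> carrier P"
    using X_pow_low[OF const_low[OF a(1)]] a by auto
  have "coeff P (p \<ominus>\<^bsub>P\<^esub> ?t) i = \<zero>" if "k \<le> i" for i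
  proof -
    have "coeff P (p \<ominus>\<^bsub>P\<^esub> ?t) i = coeff P p i \<ominus> coeff P ?t i"
      using p t(2) by (simp add: P.minus_eq R.minus_eq)
    moreover have "coeff P p i = coeff P ?t i"
    proof (cases "i = k")
      case True
      then show ?thesis using a by (simp only: coeff_X_pow_const[OF a(1)])
    next
      case False
      then have "Suc k \<le> i" using that by simp
      then show ?thesis using Suc.prems t(1) by (simp only: low_def mem_Collect_eq)
    qed
    ultimately show ?thesis using t(2) by (simp only: coeff_closed R.r_right_minus_eq)
  qed
  then have "p \<ominus>\<^bsub>P\<^esub> ?t \<in> low k" using p t by (simp add: low_def)
  then obtain w where w: "w \<in> {..<k} \<rightarrow>\<^sub>E carrier R" "rpoly k w = p \<ominus>\<^bsub>P\<^esub> ?t"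
    using Suc.IH by blast
  have "rpoly (Suc k) (w(k := a)) = (p \<ominus>\<^bsub>P\<^esub> ?t) \<oplus>\<^bsub>P\<^esub> ?t"
  proof -
    have "rpoly k (w(k := a)) = rpoly k w" by (rule rpoly_cong) simp
    then show ?thesis by (simp only: rpoly.simps fun_upd_same w(2))
  qed
  also have "\<dots> = p" using p t by (simp add: P.minus_eq P.a_assoc P.l_neg)
  finally have "rpoly (Suc k) (w(k := a)) = p" .
  moreover have "w(k := a) \<in> {..<Suc k} \<rightarrow>\<^sub>E carrier R"
    unfolding lessThan_Suc using a(1) w(1) by (rule PiE_fun_upd)
  ultimately show ?case by blast
qed

section \<open>Passing from a monomorphism over the Ore extension to one over
  \<open>R\<close>\<close>

text \<open>
  On vectors with entries \<open>q * rpoly a w\<close>, \<open>f\<close> is an \<open>R\<close>-linear injection from a free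
  module of rank \<open>a * (n + 1)\<close> to one of rank \<open>b * n\<close>. Both bases are numbered by division
  with remainder, by \<open>a\<close> and by \<open>b\<close>.
\<close>

lemma not_RSRC_of_restriction:
  assumes f: "f \<in> free_right_hom S (n + 1) n"
    and inj: "inj_on f ({..<n + 1} \<rightarrow>\<^sub>E carrier S)"
    and surj: "\<sigma> ` carrier R = carrier R"
    and q: "q \<in> carrier P"
    and q_inj: "\<And>w w' i. \<lbrakk>\<And>i. i < a \<Longrightarrow> w i \<in> carrier R; \<And>i. i < a \<Longrightarrow> w' i \<in> carrier R;
      q \<otimes>\<^bsub>S\<^esub> rpoly a w = q \<otimes>\<^bsub>S\<^esub> rpoly a w'; i < a\<rbrakk> \<Longrightarrow> w i = w' i"
    and b_inj: "\<And>w w' i. \<lbrakk>\<And>i. i < b \<Longrightarrow> w i \<in> carrier R; \<And>i. i < b \<Longrightarrow> w' i \<in> carrier R;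
      rpoly b w = rpoly b w'; i < b\<rbrakk> \<Longrightarrow> w i = w' i"
    and low: "\<And>i j w. \<lbrakk>i < n; j < n + 1; \<And>i. i < a \<Longrightarrow> w i \<in> carrier R\<rbrakk> \<Longrightarrow>
      f (\<lambda>l\<in>{..<n + 1}. if l = j then \<one>\<^bsub>S\<^esub> else \<zero>\<^bsub>S\<^esub>) i \<otimes>\<^bsub>S\<^esub> (q \<otimes>\<^bsub>S\<^esub> rpoly a w) \<in> low b"
    and ab: "a * (n + 1) = b * n + 1" and pos: "0 < n" "0 < b"
  shows "\<not> RSRC R"
proof -
  interpret S: ring S by (rule ore_extension_ring)
  define \<phi> where "\<phi> w = (\<lambda>j\<in>{..<n + 1}. q \<otimes>\<^bsub>S\<^esub> rpoly a (\<lambda>i. w (j * a + i)))" for w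
  \<comment> \<open>An arbitrary choice of right coefficients; \<open>b_inj\<close> makes it unique,
    and uniqueness will give linearity.\<close>
  define crd where "crd p = (SOME w. w \<in> {..<b} \<rightarrow>\<^sub>E carrier R \<and> rpoly b w = p)" for p
  define g where "g w = (\<lambda>t\<in>{..<b * n}. crd (f (\<phi> w) (t div b)) (t mod b))" for w
  have crd: "crd p \<in> {..<b} \<rightarrow>\<^sub>E carrier R" "rpoly b (crd p) = p" if "p \<in> low b" for p
    using someI_ex[of "\<lambda>w. w \<in> {..<b} \<rightarrow>\<^sub>E carrier R \<and> rpoly b w = p"] low_rpoly[OF surj that]
    unfolding crd_def by blast+
  have crd_closed: "crd p i \<in> carrier R" if "p \<in> low b" "i < b" for p i
    using crd(1)[OF that(1)] that(2) by auto
  have idx: "j * a + i < b * n + 1" if "j < n + 1" "i < a" for j i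
  proof -
    have "j * a + i < (j + 1) * a" using that by simp
    also have "\<dots> \<le> (n + 1) * a" using that by (intro mult_le_mono1) simp
    finally show ?thesis using ab by (simp add: mult.commute)
  qed
  have w_closed: "w (j * a + i) \<in> carrier R"
    if "w \<in> {..<b * n + 1} \<rightarrow>\<^sub>E carrier R" "j < n + 1" "i < a" for w j i
    using PiE_mem[OF that(1)] idx[OF that(2,3)] by blast
  have rp: "rpoly a (\<lambda>i. w (j * a + i)) \<in> carrier P"
    if "w \<in> {..<b * n + 1} \<rightarrow>\<^sub>E carrier R" "j < n + 1" for w j
    using w_closed[OF that] by (rule rpoly_closed)
  have \<phi>: "\<phi> w \<in> {..<n + 1} \<rightarrow>\<^sub>E carrier S" if "w \<in> {..<b * n + 1} \<rightarrow>\<^sub>E carrier R" for w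
    using rp[OF that] q unfolding \<phi>_def by (auto simp del: mult_Suc_right)
  have f_low: "f (\<phi> w) i \<in> low b" if w: "w \<in> {..<b * n + 1} \<rightarrow>\<^sub>E carrier R" and i: "i < n" for w i
  proof -
    \<comment> \<open>Sums see only the additive structure, which \<open>S\<close> shares with
      \<open>P\<close>; this makes \<open>low_finsum\<close> applicable.\<close>
    have "(\<Oplus>\<^bsub>S\<^esub>j\<in>A. h j) = (\<Oplus>\<^bsub>P\<^esub>j\<in>A. h j)" for A :: "nat set" and h
      by (simp add: finsum_def )
    then show ?thesis
      unfolding S.free_right_hom_eq_matrix[OF f \<phi>[OF w] i]
      using low[OF i _ w_closed[OF w]] by (auto simp: \<phi>_def intro!: low_finsum)
  qed
  have t: "t div b < n" "t mod b < b" if "t < b * n" for t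
    using that pos by (auto simp: less_mult_imp_div_less mult.commute)
  have hom_add: "f (\<lambda>l\<in>{..<n + 1}. x l \<oplus>\<^bsub>S\<^esub> y l) i = f x i \<oplus>\<^bsub>S\<^esub> f y i"
    if "x \<in> {..<n + 1} \<rightarrow>\<^sub>E carrier S" "y \<in> {..<n + 1} \<rightarrow>\<^sub>E carrier S" "i < n" for x y i
    using f that unfolding free_right_hom_def by simp
  have hom_scal: "f (\<lambda>l\<in>{..<n + 1}. x l \<otimes>\<^bsub>S\<^esub> r) i = f x i \<otimes>\<^bsub>S\<^esub> r"
    if "x \<in> {..<n + 1} \<rightarrow>\<^sub>E carrier S" "r \<in> carrier S" "i < n" for x r i
    using f that unfolding free_right_hom_def by simp
  have "g \<in> free_right_hom R (b * n + 1) (b * n)"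
    unfolding free_right_hom_def mem_Collect_eq
  proof (intro conjI ballI)
    show "g \<in> ({..<b * n + 1} \<rightarrow>\<^sub>E carrier R) \<rightarrow> {..<b * n} \<rightarrow>\<^sub>E carrier R"
      using f_low t crd_closed unfolding g_def by auto
  next
    fix v w
    assume v: "v \<in> {..<b * n + 1} \<rightarrow>\<^sub>E carrier R" and w: "w \<in> {..<b * n + 1} \<rightarrow>\<^sub>E carrier R"
    let ?u = "\<lambda>i\<in>{..<b * n + 1}. v i \<oplus> w i"
    have "\<phi> ?u = (\<lambda>j\<in>{..<n + 1}. \<phi> v j \<oplus>\<^bsub>S\<^esub> \<phi> w j)"
    proof (rule ext)
      fix j show "\<phi> ?u j = (\<lambda>j\<in>{..<n + 1}. \<phi> v j \<oplus>\<^bsub>S\<^esub> \<phi> w j) j"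
      proof (cases "j < n + 1")
        case True
        have "rpoly a (\<lambda>i. ?u (j * a + i)) = rpoly a (\<lambda>i. v (j * a + i) \<oplus> w (j * a + i))"
          using idx[OF True] by (intro rpoly_cong) simp
        also have "\<dots> = rpoly a (\<lambda>i. v (j * a + i)) \<oplus>\<^bsub>S\<^esub> rpoly a (\<lambda>i. w (j * a + i))"
          using rpoly_add[of a "\<lambda>i. v (j * a + i)" "\<lambda>i. w (j * a + i)"]
            w_closed[OF v True] w_closed[OF w True] by simp
        finally show ?thesis
          using True q rp[OF v True] rp[OF w True] S.r_distr by (simp add: \<phi>_def)
      qed (simp add: \<phi>_def)
    qed
    then have F: "f (\<phi> ?u) i = f (\<phi> v) i \<oplus>\<^bsub>P\<^esub> f (\<phi> w) i" if "i < n" for i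
      using hom_add[OF \<phi>[OF v] \<phi>[OF w] that] by simp
    \<comment> \<open>Both coefficient families expand to the same polynomial, so
      \<open>b_inj\<close> identifies them.\<close>
    have C: "crd (p \<oplus>\<^bsub>P\<^esub> p') i = crd p i \<oplus> crd p' i" if "p \<in> low b" "p' \<in> low b" "i < b" for p p' i
    proof (rule b_inj[OF _ _ _ \<open>i < b\<close>])
      show "rpoly b (crd (p \<oplus>\<^bsub>P\<^esub> p')) = rpoly b (\<lambda>i. crd p i \<oplus> crd p' i)"
        using that crd_closed by (simp add: rpoly_add crd(2) low_add)
    qed (use that crd_closed low_add in auto)
    show "g ?u = (\<lambda>j\<in>{..<b * n}. g v j \<oplus> g w j)"
    proof (rule ext)
      fix s show "g ?u s = (\<lambda>j\<in>{..<b * n}. g v j \<oplus> g w j) s"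
      proof (cases "s < b * n")
        case True
        then have "g ?u s = crd (f (\<phi> ?u) (s div b)) (s mod b)" by (simp add: g_def)
        also have "\<dots> = crd (f (\<phi> v) (s div b)) (s mod b) \<oplus> crd (f (\<phi> w) (s div b)) (s mod b)"
          unfolding F[OF t(1)[OF True]] using C f_low v w t True by simp
        finally show ?thesis using True by (simp add: g_def)
      qed (simp add: g_def)
    qed
  next
    fix v r
    assume v: "v \<in> {..<b * n + 1} \<rightarrow>\<^sub>E carrier R" and r: "r \<in> carrier R"
    let ?u = "\<lambda>i\<in>{..<b * n + 1}. v i \<otimes> r"
    let ?r = "monom P r 0"
    have r': "?r \<in> carrier S" using r by simp
    have "\<phi> ?u = (\<lambda>j\<in>{..<n + 1}. \<phi> v j \<otimes>\<^bsub>S\<^esub> ?r)"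
    proof (rule ext)
      fix j show "\<phi> ?u j = (\<lambda>j\<in>{..<n + 1}. \<phi> v j \<otimes>\<^bsub>S\<^esub> ?r) j"
      proof (cases "j < n + 1")
        case True
        have "rpoly a (\<lambda>i. ?u (j * a + i)) = rpoly a (\<lambda>i. v (j * a + i) \<otimes> r)"
          using idx[OF True] by (intro rpoly_cong) simp
        also have "\<dots> = rpoly a (\<lambda>i. v (j * a + i)) \<otimes>\<^bsub>S\<^esub> ?r"
          using rpoly_scale[of a "\<lambda>i. v (j * a + i)"] w_closed[OF v True] r by simp
        finally show ?thesis
          using True q rp[OF v True] r by (simp add: \<phi>_def mult_assoc)
      qed (simp add: \<phi>_def)
    qed
    then have F: "f (\<phi> ?u) i = f (\<phi> v) i \<otimes>\<^bsub>S\<^esub> ?r" if "i < n" for i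
      using hom_scal[OF \<phi>[OF v] r' that] by simp
    have C: "crd (p \<otimes>\<^bsub>S\<^esub> ?r) i = crd p i \<otimes> r" if p: "p \<in> low b" and i: "i < b" for p i
    proof -
      have eq: "rpoly b (\<lambda>i. crd p i \<otimes> r) = p \<otimes>\<^bsub>S\<^esub> ?r"
        using p r crd_closed by (simp add: rpoly_scale crd(2))
      have "rpoly b (\<lambda>i. crd p i \<otimes> r) \<in> low b"
        using p r crd_closed by (intro rpoly_low) simp
      then have pr: "p \<otimes>\<^bsub>S\<^esub> ?r \<in> low b" by (simp add: eq)
      show ?thesis
      proof (rule b_inj[OF _ _ _ i])
        show "rpoly b (crd (p \<otimes>\<^bsub>S\<^esub> ?r)) = rpoly b (\<lambda>i. crd p i \<otimes> r)"
          by (simp add: eq crd(2)[OF pr])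
      qed (use p r pr crd_closed in auto)
    qed
    show "g ?u = (\<lambda>j\<in>{..<b * n}. g v j \<otimes> r)"
    proof (rule ext)
      fix s show "g ?u s = (\<lambda>j\<in>{..<b * n}. g v j \<otimes> r) s"
      proof (cases "s < b * n")
        case True
        then have "g ?u s = crd (f (\<phi> ?u) (s div b)) (s mod b)" by (simp add: g_def)
        also have "\<dots> = crd (f (\<phi> v) (s div b)) (s mod b) \<otimes> r"
          unfolding F[OF t(1)[OF True]] using C f_low v t True by simp
        finally show ?thesis using True by (simp add: g_def)
      qed (simp add: g_def)
    qed
  qed
  \<comment> \<open>Three injections are undone in turn: taking coordinates of the entries, then
    \<open>f\<close>, then \<open>w \<mapsto> q * rpoly a w\<close> in each block.\<close>
  moreover have "inj_on g ({..<b * n + 1} \<rightarrow>\<^sub>E carrier R)"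
  proof (rule inj_onI)
    fix v w
    assume v: "v \<in> {..<b * n + 1} \<rightarrow>\<^sub>E carrier R" and w: "w \<in> {..<b * n + 1} \<rightarrow>\<^sub>E carrier R"
      and gvw: "g v = g w"
    have "f (\<phi> v) i = f (\<phi> w) i" if i: "i < n" for i
    proof -
      have "crd (f (\<phi> v) i) l = crd (f (\<phi> w) i) l" if l: "l < b" for l
      proof -
        \<comment> \<open>Coefficient \<open>l\<close> of entry \<open>i\<close> is stored at
          position \<open>i * b + l\<close>.\<close>
        have "i * b + l < (i + 1) * b" using l by simp
        also have "\<dots> \<le> n * b" using i by (intro mult_le_mono1) simp
        finally have "i * b + l < b * n" by (simp add: mult.commute)
        moreover have "(i * b + l) div b = i" "(i * b + l) mod b = l" using l by auto
        ultimately show ?thesis using fun_cong[OF gvw, of "i * b + l"] by (simp add: g_def)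
      qed
      then have "rpoly b (crd (f (\<phi> v) i)) = rpoly b (crd (f (\<phi> w) i))" by (rule rpoly_cong)
      then show ?thesis using crd(2) f_low v w i by simp
    qed
    moreover have "f (\<phi> x) \<in> {..<n} \<rightarrow>\<^sub>E carrier S"
      if "x \<in> {..<b * n + 1} \<rightarrow>\<^sub>E carrier R" for x
      using f \<phi>[OF that] unfolding free_right_hom_def by blast
    ultimately have "f (\<phi> v) = f (\<phi> w)" using v w by (metis PiE_ext lessThan_iff)
    then have \<phi>vw: "\<phi> v = \<phi> w" using inj_onD[OF inj] \<phi> v w by blast
    show "v = w"
    proof (rule PiE_ext[OF v w])
      fix s assume "s \<in> {..<b * n + 1}"
      then have s: "s < (n + 1) * a" using ab by (simp add: mult.commute)
      then have "0 < a" by (cases a) auto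
      then have j: "s div a < n + 1" "s mod a < a" using s by (auto simp: less_mult_imp_div_less)
      have eq: "q \<otimes>\<^bsub>S\<^esub> rpoly a (\<lambda>i. v (s div a * a + i)) = q \<otimes>\<^bsub>S\<^esub> rpoly a (\<lambda>i. w (s div a * a + i))"
        using fun_cong[OF \<phi>vw, of "s div a"] j by (simp add: \<phi>_def)
      show "v s = w s"
        using q_inj[OF w_closed[OF v j(1)] w_closed[OF w j(1)] eq j(2)] by simp
    qed
  qed
  \<comment> \<open>\<open>RSRC\<close> speaks only of positive ranks.\<close>
  moreover have "0 < b * n" using pos by simp
  ultimately show ?thesis unfolding RSRC_def by blast
qed

section \<open>Lowering degrees by a kernel element of \<open>\<sigma>\<close>\<close>

text \<open>Since \<open>x r = \<delta>(r)\<close> is constant, \<open>x^i r\<close> has degree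
  below \<open>i\<close> for positive \<open>i\<close>. Hence each right multiplication by
  \<open>r\<close> lowers a positive degree bound by one, and \<open>d\<close> of them reach
  \<open>R\<close>.\<close>

lemma low_mult_kernel_pow:
  assumes r: "r \<in> carrier R" "\<sigma> r = \<zero>"
  shows "s \<in> low (Suc d) \<Longrightarrow> s \<otimes>\<^bsub>S\<^esub> monom P (r [^] d) 0 \<in> low (Suc 0)"
proof (induction d arbitrary: s)
  case 0
  then show ?case using low_mult[OF 0 const_low[of \<one>]] by simp
next
  case (Suc d)
  have s: "s \<in> carrier P" using Suc.prems low_carrier by blast
  have "(X ^^ i) (monom P r 0) \<in> low (Suc d)" if "i \<le> Suc d" for i
  proof (cases i)
    case 0
    then show ?thesis using const_low[OF r(1)] by (auto intro: low_mono)
  next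
    case (Suc j)
    have "X (monom P r 0) = monom P (\<delta> r) 0" using r by (simp add: X_monom)
    then have "(X ^^ i) (monom P r 0) = (X ^^ j) (monom P (\<delta> r) 0)"
      using Suc by (simp add: funpow_swap1)
    then show ?thesis
      using X_pow_low[OF const_low, of "\<delta> r" j] r Suc that by (auto intro: low_mono)
  qed
  then have "trunc (Suc d) s (monom P r 0) \<in> low (Suc d)"
    unfolding trunc_def using s by (intro low_finsum low_smult) auto
  then have "s \<otimes>\<^bsub>S\<^esub> monom P r 0 \<in> low (Suc d)"
    using mult_eq[OF s _ low_bound[OF Suc.prems], of "monom P r 0"] r by simp
  \<comment> \<open>The extra factor is split off on the left of the power, since it is the one that
    meets \<open>s\<close> first.\<close>
  from Suc.IH[OF this] have "s \<otimes>\<^bsub>S\<^esub> monom P (r \<otimes> r [^] d) 0 \<in> low (Suc 0)"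
    using s r by (simp add: mult_assoc const_mult)
  then show ?case using R.nat_pow_Suc2[OF r(1)] by simp
qed

section \<open>The two cases: \<open>\<sigma>\<close> injective or not\<close>

theorem ore_extension_RSRC:
  assumes dom: "noncomm_domain R" and surj: "\<sigma> ` carrier R = carrier R" and RSRC: "RSRC R"
  shows "RSRC S"
proof (rule ccontr)
  interpret S: ring S by (rule ore_extension_ring)
  assume "\<not> RSRC S"
  then obtain n f where n: "0 < n" and f: "f \<in> free_right_hom S (n + 1) n"
    and inj: "inj_on f ({..<n + 1} \<rightarrow>\<^sub>E carrier S)"
    unfolding RSRC_def by blast
  define m where "m i j = f (\<lambda>l\<in>{..<n + 1}. if l = j then \<one>\<^bsub>S\<^esub> else \<zero>\<^bsub>S\<^esub>) i" for i j
  have m_closed: "m i j \<in> carrier P" if "i < n" for i j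
  proof -
    have "(\<lambda>l\<in>{..<n + 1}. if l = j then \<one>\<^bsub>S\<^esub> else \<zero>\<^bsub>S\<^esub>) \<in> {..<n + 1} \<rightarrow>\<^sub>E carrier S" by auto
    then have "f (\<lambda>l\<in>{..<n + 1}. if l = j then \<one>\<^bsub>S\<^esub> else \<zero>\<^bsub>S\<^esub>) \<in> {..<n} \<rightarrow>\<^sub>E carrier S"
      using f unfolding free_right_hom_def by blast
    then show ?thesis using that unfolding m_def by (auto dest: PiE_mem)
  qed
  obtain D where D: "\<And>i j. i < n \<Longrightarrow> m i j \<in> low (Suc (D i j))"
    using ex_low[OF m_closed] by metis
  \<comment> \<open>A sum of naturals bounds each summand, so \<open>d\<close> is a common degree
    bound for the whole matrix.\<close>
  define d where "d = (\<Sum>i<n. \<Sum>j<n+1. D i j)"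
  have m_low: "m i j \<in> low (Suc d)" if "i < n" "j < n + 1" for i j
  proof -
    have "D i j \<le> (\<Sum>j<n+1. D i j)" using that by (intro member_le_sum) auto
    also have "\<dots> \<le> d" unfolding d_def using that by (intro member_le_sum) auto
    finally show ?thesis using D[OF that(1)] by (auto intro: low_mono)
  qed
  show False
  proof (cases "inj_on \<sigma> (carrier R)")
    case True
    have "\<not> RSRC R"
    \<comment> \<open>The matrix raises degrees by at most \<open>d\<close>, so \<open>b\<close> is
      taken as \<open>a + d\<close>; the rank equation \<open>a * (n + 1) = b * n + 1\<close> then
      forces \<open>a = d * n + 1\<close>.\<close>
    proof (rule not_RSRC_of_restriction[OF f inj surj, where q = "\<one>\<^bsub>P\<^esub>" and a = "d * n + 1"
          and b = "d * n + d + 1", folded m_def])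
      fix w w' :: "nat \<Rightarrow> 'a" and i
      assume w: "\<And>i. i < d * n + 1 \<Longrightarrow> w i \<in> carrier R" "\<And>i. i < d * n + 1 \<Longrightarrow> w' i \<in> carrier R"
        and eq: "\<one>\<^bsub>P\<^esub> \<otimes>\<^bsub>S\<^esub> rpoly (d * n + 1) w = \<one>\<^bsub>P\<^esub> \<otimes>\<^bsub>S\<^esub> rpoly (d * n + 1) w'"
        and i: "i < d * n + 1"
      have "rpoly (d * n + 1) w = rpoly (d * n + 1) w'"
        using eq one_mult rpoly_closed w by metis
      then show "w i = w' i" by (intro rpoly_inj[OF True _ _ _ i]) (use w in auto)
    next
      fix w w' :: "nat \<Rightarrow> 'a" and i
      assume "\<And>i. i < d * n + d + 1 \<Longrightarrow> w i \<in> carrier R"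
        "\<And>i. i < d * n + d + 1 \<Longrightarrow> w' i \<in> carrier R"
        "rpoly (d * n + d + 1) w = rpoly (d * n + d + 1) w'" "i < d * n + d + 1"
      then show "w i = w' i" by (rule rpoly_inj[OF True])
    next
      fix i j w assume ij: "i < n" "j < n + 1" and w: "\<And>i. i < d * n + 1 \<Longrightarrow> w i \<in> carrier R"
      have "m i j \<otimes>\<^bsub>S\<^esub> rpoly (d * n + 1) w \<in> low (d + (d * n + 1))"
        by (rule low_mult[OF m_low[OF ij] rpoly_low]) (rule w)
      moreover have "d + (d * n + 1) = d * n + d + 1" by simp
      moreover have "\<one>\<^bsub>P\<^esub> \<otimes>\<^bsub>S\<^esub> rpoly (d * n + 1) w = rpoly (d * n + 1) w"
        by (rule one_mult[OF rpoly_closed]) (rule w)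
      ultimately show "m i j \<otimes>\<^bsub>S\<^esub> (\<one>\<^bsub>P\<^esub> \<otimes>\<^bsub>S\<^esub> rpoly (d * n + 1) w) \<in> low (d * n + d + 1)"
        by (simp only:)
    next
      show "(d * n + 1) * (n + 1) = (d * n + d + 1) * n + 1"
        by (simp add: algebra_simps)
      show "\<one>\<^bsub>P\<^esub> \<in> carrier P" "0 < n" "0 < d * n + d + 1"
        using n by simp_all
    qed
    then show False using RSRC by blast
  next
    case False
    then obtain s t where st: "s \<in> carrier R" "t \<in> carrier R" "\<sigma> s = \<sigma> t" "s \<noteq> t"
      unfolding inj_on_def by blast
    define r where "r = s \<ominus> t"
    \<comment> \<open>Adding and subtracting \<open>\<sigma> t\<close> reduces the claim to
      additivity of \<open>\<sigma>\<close>.\<close>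
    have "\<sigma> (s \<ominus> t) = \<sigma> (s \<ominus> t) \<oplus> \<sigma> t \<ominus> \<sigma> t"
      using st by (simp add: R.minus_eq R.a_assoc R.r_neg)
    also have "\<dots> = \<sigma> (s \<ominus> t \<oplus> t) \<ominus> \<sigma> t" using st by simp
    also have "\<dots> = \<zero>" using st by (simp add: R.minus_eq R.a_assoc R.l_neg R.r_neg)
    finally have r: "r \<in> carrier R" "\<sigma> r = \<zero>" "r \<noteq> \<zero>" using st by (auto simp: r_def)
    \<comment> \<open>In a domain \<open>r\<close> is not nilpotent, so left multiplication by
      \<open>r [^] d\<close> can be cancelled.\<close>
    have pow: "r [^] k \<noteq> \<zero>" for k :: nat
      using noncomm_domain.integral[OF dom] noncomm_domain.one_not_zero[OF dom] r
      by (induction k) auto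
    have q: "r [^] d \<in> carrier R" using r by simp
    have const: "rpoly 1 w = monom P (w 0) 0" if "w 0 \<in> carrier R" for w
      using that by simp
    have "\<not> RSRC R"
    proof (rule not_RSRC_of_restriction[OF f inj surj, where q = "monom P (r [^] d) 0" and a = 1
          and b = 1, folded m_def])
      fix w w' :: "nat \<Rightarrow> 'a" and i :: nat
      assume "\<And>i. i < 1 \<Longrightarrow> w i \<in> carrier R" "\<And>i. i < 1 \<Longrightarrow> w' i \<in> carrier R"
        and eq: "monom P (r [^] d) 0 \<otimes>\<^bsub>S\<^esub> rpoly 1 w = monom P (r [^] d) 0 \<otimes>\<^bsub>S\<^esub> rpoly 1 w'"
        and i: "i < 1"
      then have w: "w 0 \<in> carrier R" "w' 0 \<in> carrier R" by auto
      have "monom P (r [^] d \<otimes> w 0) 0 = monom P (r [^] d \<otimes> w' 0) 0"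
        using eq w q by (simp only: const const_mult)
      then have "r [^] d \<otimes> w 0 = r [^] d \<otimes> w' 0"
        using w q by (metis coeff_monom R.m_closed)
      then have "r [^] d \<otimes> (w 0 \<ominus> w' 0) = \<zero>"
        using w q by (simp add: R.minus_eq R.r_distr R.r_minus R.r_neg)
      then have "w 0 \<ominus> w' 0 = \<zero>"
        using noncomm_domain.integral[OF dom] w q pow by (metis R.minus_closed)
      then show "w i = w' i" using w i by simp
    next
      fix w w' :: "nat \<Rightarrow> 'a" and i :: nat
      assume "\<And>i. i < 1 \<Longrightarrow> w i \<in> carrier R" "\<And>i. i < 1 \<Longrightarrow> w' i \<in> carrier R"
        and "rpoly 1 w = rpoly 1 w'" and i: "i < 1"
      \<comment> \<open>Expansions of length one are constants, hence unique even though
        \<open>\<sigma>\<close> is not injective.\<close>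
      then have "w 0 = w' 0" by (metis coeff_monom const less_one)
      then show "w i = w' i" using i by simp
    next
      fix i j and w :: "nat \<Rightarrow> 'a"
      assume ij: "i < n" "j < n + 1" and "\<And>i. i < 1 \<Longrightarrow> w i \<in> carrier R"
      then have w: "w 0 \<in> carrier R" by simp
      \<comment> \<open>With this bracketing the power of \<open>r\<close> first brings the matrix
        entry into \<open>R\<close>; multiplying by \<open>w 0\<close> then stays there.\<close>
      have "(m i j \<otimes>\<^bsub>S\<^esub> monom P (r [^] d) 0) \<otimes>\<^bsub>S\<^esub> monom P (w 0) 0 \<in> low (0 + Suc 0)"
        using low_mult[OF low_mult_kernel_pow[OF r(1,2) m_low[OF ij]] const_low[OF w]] .
      then show "m i j \<otimes>\<^bsub>S\<^esub> (monom P (r [^] d) 0 \<otimes>\<^bsub>S\<^esub> rpoly 1 w) \<in> low 1"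
        using w q m_closed[OF ij(1), of j] by (simp add: const mult_assoc)
    qed (use n q in auto)
    then show False using RSRC by blast
  qed
qed

end

theorem corollary0p3:
  fixes R :: "('a, 'm) ring_scheme" and \<sigma> \<delta> :: "'a \<Rightarrow> 'a"
  assumes "noncomm_domain R"
    and "\<sigma> \<in> ring_hom R R" and "\<sigma> ` carrier R = carrier R"
    and "sigma_derivation R \<sigma> \<delta>"
    and "RSRC R"
  shows "RSRC (ore_extension R \<sigma> \<delta>)"
proof -
  interpret R: noncomm_domain R by (rule assms(1))
  interpret ore_data R "UP R" \<sigma> \<delta> "ore_extension R \<sigma> \<delta>"
    using assms(2,4) R.ring_axioms by (simp_all add: ore_data_def ore_data_axioms_def UP_ring_def)
  show ?thesis using ore_extension_RSRC assms(1,3,5) by blast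
qed

end
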